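(* Let $f\colon M\to M$ be a homeomorphism of a compact metric space $(M,d)$. Every L-shadowing map for $f$ is a shadowing map for $f$.
   Context: $\tilde M=M^{\mathbb Z}$ has the product topology; $\sigma\colon\tilde M\to\tilde M$ is the shift, $(\sigma(x))_i=x_{i+1}$; for $p\in M$, $\mathrm{orb}_f(p)\in\tilde M$ is given by $(\mathrm{orb}_f(p))_i=f^i(p)$. For $\delta\ge 0$, $\tilde M(f,\delta)=\{x\in\tilde M: d(x_{i+1},f(x_i))\le\delta\ \forall i\in\mathbb Z\}$; its elements are called $\delta$-orbits. A sequence $x\in\tilde M$ is a two-sided limit pseudo-orbit if $d(f(x_i),x_{i+1})\to0$ as $|i|\to\infty$. A point $p\in M$ $\epsilon$-shadows $x$ if $d(f^i(p),x_i)\le\epsilon$ for all $i\in\mathbb Z$, and two-sided limit shadows $x$ if $d(f^i(p),x_i)\to0$ as $|i|\to\infty$. A pseudo-orbit map for $f$ is a continuous map $\mathrm{Sh}_f\colon\tilde M(f,\delta)\to M$ (for some $\delta>0$) with $\mathrm{Sh}_f(\mathrm{orb}_f(p))=p$ for all $p\in M$. It is a shadowing map if for all $\epsilon>0$ there is $\gamma\in(0,\delta]$ such that $d(f^i(\mathrm{Sh}_f(x)),\mathrm{Sh}_f(\sigma^i(x)))\le\epsilon$ for all $x\in\tilde M(f,\gamma)$ and $i\in\mathbb Z$. It is an L-shadowing map if for all $\epsilon>0$ there is $\gamma\in(0,\delta]$ such that for every $\gamma$-orbit $x$ that is also a two-sided limit pseudo-orbit, $\mathrm{Sh}_f(x)$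 both $\epsilon$-shadows and two-sided limit shadows $x$. *)

theory Defs
  imports "HOL-Analysis.Analysis"
begin

text \<open>
  The space \<open>M\<close> is a type \<open>'a\<close> of class \<^class>\<open>metric_space\<close>, and \<open>M\<^sup>\<int>\<close> is the type
  \<open>int \<Rightarrow> 'a\<close>, whose \<^class>\<open>topological_space\<close> instance is the product topology.
\<close>

text \<open>The iterate \<open>f\<^sup>i\<close> for \<open>i \<in> \<int>\<close>; meaningful for bijective \<open>f\<close>.\<close>

definition int_iter :: "('b \<Rightarrow> 'b) \<Rightarrow> int \<Rightarrow> 'b \<Rightarrow> 'b" where
  "int_iter f i = (if i \<ge> 0 then f ^^ nat i else inv f ^^ nat (- i))"

definition shift :: "(int \<Rightarrow> 'a) \<Rightarrow> (int \<Rightarrow> 'a)" where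
  "shift x = (\<lambda>i. x (i + 1))"

definition orb :: "('a \<Rightarrow> 'a) \<Rightarrow> 'a \<Rightarrow> (int \<Rightarrow> 'a)" where
  "orb f p = (\<lambda>i. int_iter f i p)"

definition pseudo_orbits :: "('a::metric_space \<Rightarrow> 'a) \<Rightarrow> real \<Rightarrow> (int \<Rightarrow> 'a) set" where
  "pseudo_orbits f \<delta> = {x. \<forall>i. dist (x (i + 1)) (f (x i)) \<le> \<delta>}"

text \<open>The filter of \<open>\<bar>i\<bar> \<rightarrow> \<infinity>\<close>.\<close>

abbreviation int_at_infinity :: "int filter" where
  "int_at_infinity \<equiv> filtercomap (\<lambda>i. \<bar>i\<bar>) at_top"

definition two_sided_limit_pseudo_orbit :: "('a::metric_space \<Rightarrow> 'a) \<Rightarrow> (int \<Rightarrow> 'a) \<Rightarrow> bool" where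
  "two_sided_limit_pseudo_orbit f x \<longleftrightarrow>
     ((\<lambda>i. dist (f (x i)) (x (i + 1))) \<longlongrightarrow> 0) int_at_infinity"

definition shadows :: "('a::metric_space \<Rightarrow> 'a) \<Rightarrow> real \<Rightarrow> 'a \<Rightarrow> (int \<Rightarrow> 'a) \<Rightarrow> bool" where
  "shadows f \<epsilon> p x \<longleftrightarrow> (\<forall>i. dist (int_iter f i p) (x i) \<le> \<epsilon>)"

definition two_sided_limit_shadows :: "('a::metric_space \<Rightarrow> 'a) \<Rightarrow> 'a \<Rightarrow> (int \<Rightarrow> 'a) \<Rightarrow> bool" where
  "two_sided_limit_shadows f p x \<longleftrightarrow>
     ((\<lambda>i. dist (int_iter f i p) (x i)) \<longlongrightarrow> 0) int_at_infinity"

text \<open>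
  A map \<open>Sh\<close> on the \<open>\<delta>\<close>-orbits is represented by a total function together with \<open>\<delta>\<close>;
  its values outside \<open>pseudo_orbits f \<delta>\<close> are irrelevant to all of the following notions.
\<close>

definition pseudo_orbit_map ::
  "('a::metric_space \<Rightarrow> 'a) \<Rightarrow> real \<Rightarrow> ((int \<Rightarrow> 'a) \<Rightarrow> 'a) \<Rightarrow> bool" where
  "pseudo_orbit_map f \<delta> Sh \<longleftrightarrow>
     \<delta> > 0 \<and> continuous_on (pseudo_orbits f \<delta>) Sh \<and> (\<forall>p. Sh (orb f p) = p)"

definition shadowing_map ::
  "('a::metric_space \<Rightarrow> 'a) \<Rightarrow> real \<Rightarrow> ((int \<Rightarrow> 'a) \<Rightarrow> 'a) \<Rightarrow> bool" where
  "shadowing_map f \<delta> Sh \<longleftrightarrow> pseudo_orbit_map f \<delta> Sh \<and>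
     (\<forall>\<epsilon>>0. \<exists>\<gamma>\<in>{0<..\<delta>}. \<forall>x\<in>pseudo_orbits f \<gamma>. \<forall>i.
        dist (int_iter f i (Sh x)) (Sh (int_iter shift i x)) \<le> \<epsilon>)"

definition L_shadowing_map ::
  "('a::metric_space \<Rightarrow> 'a) \<Rightarrow> real \<Rightarrow> ((int \<Rightarrow> 'a) \<Rightarrow> 'a) \<Rightarrow> bool" where
  "L_shadowing_map f \<delta> Sh \<longleftrightarrow> pseudo_orbit_map f \<delta> Sh \<and>
     (\<forall>\<epsilon>>0. \<exists>\<gamma>\<in>{0<..\<delta>}. \<forall>x\<in>pseudo_orbits f \<gamma>. two_sided_limit_pseudo_orbit f x \<longrightarrow>
        shadows f \<epsilon> (Sh x) x \<and> two_sided_limit_shadows f (Sh x) x)"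

end

theory Submission
  imports Defs
begin

text \<open>
  A pseudo-orbit \<open>x\<close> need not be a limit pseudo-orbit, so the L-shadowing property says nothing
  about it directly. But \<open>x\<close> is the limit, in the product topology, of the pseudo-orbits that agree
  with \<open>x\<close> on \<open>[-n, n]\<close> and continue as exact orbits outside (\<open>tendsto_truncate_orbit\<close>). These have
  no jumps far away, hence are limit pseudo-orbits, and their jumps are no larger than those
  of \<open>x\<close>. The inequality \<open>d(f\<^sup>i(Sh x), x\<^sub>i) \<le> \<epsilon>\<close> is a closed condition on \<open>x\<close> because \<open>Sh\<close> and
  \<open>f\<^sup>i\<close> are continuous, so it passes to the limit: \<open>Sh x\<close> shadows every pseudo-orbit \<open>x\<close> with small
  jumps (\<open>L_shadowing_map_shadows\<close>).

  Now \<open>\<sigma>\<^sup>i x\<close> has the same jumps as \<open>x\<close> and has \<open>x\<^sub>i\<close> at index \<open>0\<close>, so \<open>Sh (\<sigma>\<^sup>i x)\<close> is close to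
  \<open>x\<^sub>i\<close>. As \<open>f\<^sup>i(Sh x)\<close> is close to \<open>x\<^sub>i\<close> too, the triangle inequality gives the shadowing property.
\<close>

lemma int_iter_0 [simp]: "int_iter f 0 p = p"
  by (simp add: int_iter_def)

lemma int_iter_succ:
  assumes "bij f"
  shows "int_iter f (i + 1) p = f (int_iter f i p)"
proof (cases "i \<ge> 0")
  case True
  then have "nat (i + 1) = Suc (nat i)" by simp
  with True show ?thesis by (simp add: int_iter_def)
next
  case False
  then have *: "nat (- i) = Suc (nat (- (i + 1)))" by simp
  have "f (int_iter f i p) = (inv f ^^ nat (- (i + 1))) p"
    unfolding int_iter_def * using False assms by (simp add: bij_is_surj surj_f_inv_f)
  with False show ?thesis by (cases "i = -1") (simp_all add: int_iter_def)
qed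

lemma continuous_on_int_iter:
  fixes f :: "'a::topological_space \<Rightarrow> 'a"
  assumes "continuous_on UNIV f" "continuous_on UNIV (inv f)"
  shows "continuous_on UNIV (int_iter f i)"
proof -
  have "continuous_on UNIV (g ^^ n)" if "continuous_on UNIV g" for g :: "'a \<Rightarrow> 'a" and n
  proof (induction n)
    case (Suc n)
    show ?case
      unfolding funpow.simps comp_def by (rule continuous_on_compose2[OF that Suc]) simp
  qed (simp add: id_def)
  with assms show ?thesis by (simp add: int_iter_def)
qed

lemma int_iter_shift: "int_iter shift i x = (\<lambda>j. x (j + i))"
proof -
  have inv_shift: "inv shift = (\<lambda>x j. x (j - 1))"
    by (rule inv_unique_comp) (auto simp: shift_def fun_eq_iff)
  have "(inv shift ^^ n) x = (\<lambda>j. x (j - int n))" for n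
    by (induction n) (auto simp: inv_shift algebra_simps)
  moreover have "(shift ^^ n) x = (\<lambda>j. x (j + int n))" for n
    by (induction n) (auto simp: shift_def algebra_simps)
  ultimately show ?thesis by (auto simp: int_iter_def)
qed

lemma int_iter_shift_pseudo_orbits:
  assumes "x \<in> pseudo_orbits f \<gamma>"
  shows "int_iter shift i x \<in> pseudo_orbits f \<gamma>"
proof -
  have "dist (x (j + i + 1)) (f (x (j + i))) \<le> \<gamma>" for j
    using assms by (simp add: pseudo_orbits_def)
  then show ?thesis by (simp add: pseudo_orbits_def int_iter_shift add_ac)
qed

text \<open>
  Clamping the index to \<open>[-n, n]\<close> and applying the iterate that makes up for the difference
  describes the truncated sequence on both sides and in the middle at once.
\<close>

definition truncate_orbit :: "('a \<Rightarrow> 'a) \<Rightarrow> nat \<Rightarrow> (int \<Rightarrow> 'a) \<Rightarrow> (int \<Rightarrow> 'a)" where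
  "truncate_orbit f n x =
     (\<lambda>i. let c = max (- int n) (min (int n) i) in int_iter f (i - c) (x c))"

lemma truncate_orbit_inside: "\<bar>i\<bar> \<le> int n \<Longrightarrow> truncate_orbit f n x i = x i"
  by (simp add: truncate_orbit_def min_absorb2 max_absorb2 abs_le_iff)

text \<open>
  A step on which the clamped index does not move only adds one more application of \<open>f\<close>. The last
  such step on the left goes from \<open>-n - 1\<close> to \<open>-n\<close>, the first on the right from \<open>n\<close> to \<open>n + 1\<close>.
\<close>

lemma truncate_orbit_outside:
  assumes "bij f" "i < - int n \<or> int n \<le> i"
  shows "truncate_orbit f n x (i + 1) = f (truncate_orbit f n x i)"
proof -
  let ?c = "\<lambda>i. max (- int n) (min (int n) i)"
  have "?c (i + 1) = ?c i" using assms(2) by auto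
  then show ?thesis
    using int_iter_succ[OF assms(1), of "i - ?c i"]
    by (simp add: truncate_orbit_def Let_def algebra_simps)
qed

lemma truncate_orbit_pseudo_orbits:
  assumes "bij f" "0 \<le> \<gamma>" "x \<in> pseudo_orbits f \<gamma>"
  shows "truncate_orbit f n x \<in> pseudo_orbits f \<gamma>"
  unfolding pseudo_orbits_def
proof (rule CollectI, rule allI)
  fix i
  show "dist (truncate_orbit f n x (i + 1)) (f (truncate_orbit f n x i)) \<le> \<gamma>"
  proof (cases "i < - int n \<or> int n \<le> i")
    case True
    then show ?thesis using assms(1,2) by (simp add: truncate_orbit_outside)
  next
    case False
    then have "truncate_orbit f n x i = x i" "truncate_orbit f n x (i + 1) = x (i + 1)"
      by (auto intro!: truncate_orbit_inside)
    then show ?thesis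
      using assms(3) by (simp add: pseudo_orbits_def)
  qed
qed

lemma truncate_orbit_two_sided_limit_pseudo_orbit:
  assumes "bij f"
  shows "two_sided_limit_pseudo_orbit f (truncate_orbit f n x)"
  unfolding two_sided_limit_pseudo_orbit_def
proof (rule tendsto_eventually)
  have "eventually (\<lambda>k. k > int n) at_top" by (rule eventually_gt_at_top)
  then have "eventually (\<lambda>i. \<bar>i\<bar> > int n) int_at_infinity" by (rule eventually_filtercomapI)
  then show "eventually (\<lambda>i. dist (f (truncate_orbit f n x i)) (truncate_orbit f n x (i + 1)) = 0)
      int_at_infinity"
  proof eventually_elim
    case (elim i)
    then have "i < - int n \<or> int n \<le> i" by auto
    with assms show ?case by (simp add: truncate_orbit_outside)
  qed
qed

lemma tendsto_truncate_orbit_at: "(\<lambda>n. truncate_orbit f n x i) \<longlonglongrightarrow> x i"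
proof (rule tendsto_eventually)
  show "eventually (\<lambda>n. truncate_orbit f n x i = x i) sequentially"
    using eventually_ge_at_top[of "nat \<bar>i\<bar>"]
    by eventually_elim (rule truncate_orbit_inside, simp)
qed

lemma tendsto_truncate_orbit:
  fixes x :: "int \<Rightarrow> 'a::topological_space"
  shows "(\<lambda>n. truncate_orbit f n x) \<longlonglongrightarrow> x"
proof -
  have "limitin (product_topology (\<lambda>_. euclidean) UNIV) (\<lambda>n. truncate_orbit f n x) x sequentially"
    by (auto simp: limitin_componentwise tendsto_truncate_orbit_at)
  then show ?thesis
    by (simp only: euclidean_product_topology limitin_canonical_iff)
qed

text \<open>
  Both \<open>f\<^sup>i(Sh x)\<close> and \<open>x\<^sub>i\<close> depend continuously on the pseudo-orbit \<open>x\<close>, so shadowing of the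
  truncations is inherited by their limit, whatever the behaviour of \<open>x\<close> at infinity.
\<close>

lemma L_shadowing_map_shadows:
  fixes f :: "'a::metric_space \<Rightarrow> 'a"
  assumes f: "homeomorphism UNIV UNIV f (inv f)"
    and Sh: "L_shadowing_map f \<delta> Sh" and "\<epsilon> > 0"
  obtains \<gamma> where "\<gamma> \<in> {0<..\<delta>}" "\<And>x. x \<in> pseudo_orbits f \<gamma> \<Longrightarrow> shadows f \<epsilon> (Sh x) x"
proof -
  have bij: "bij f"
    using f by (intro o_bij[of "inv f"]) (auto simp: homeomorphism_def fun_eq_iff)
  obtain \<gamma> where \<gamma>: "\<gamma> \<in> {0<..\<delta>}" and
    shadows_limit: "\<And>x. x \<in> pseudo_orbits f \<gamma> \<Longrightarrow> two_sided_limit_pseudo_orbit f x \<Longrightarrow>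
      shadows f \<epsilon> (Sh x) x"
    using Sh \<open>\<epsilon> > 0\<close> unfolding L_shadowing_map_def by meson
  have "shadows f \<epsilon> (Sh x) x" if x: "x \<in> pseudo_orbits f \<gamma>" for x
    unfolding shadows_def
  proof
    fix i
    let ?x = "\<lambda>n. truncate_orbit f n x"
    have trunc: "?x n \<in> pseudo_orbits f \<gamma>" for n
      using truncate_orbit_pseudo_orbits[OF bij _ x] \<gamma> by simp
    have le: "dist (int_iter f i (Sh (?x n))) (?x n i) \<le> \<epsilon>" for n
      using shadows_limit[OF trunc truncate_orbit_two_sided_limit_pseudo_orbit[OF bij]]
      by (simp add: shadows_def)
    have sub: "pseudo_orbits f \<gamma> \<subseteq> pseudo_orbits f \<delta>"
      using \<gamma> by (auto simp: pseudo_orbits_def intro: order_trans[where y = \<gamma>])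
    have "continuous_on (pseudo_orbits f \<delta>) Sh"
      using Sh by (simp add: L_shadowing_map_def pseudo_orbit_map_def)
    then have "(\<lambda>n. Sh (?x n)) \<longlonglongrightarrow> Sh x"
      by (rule continuous_on_tendsto_compose[OF _ tendsto_truncate_orbit])
        (use x trunc sub in \<open>auto intro!: always_eventually\<close>)
    then have "(\<lambda>n. int_iter f i (Sh (?x n))) \<longlonglongrightarrow> int_iter f i (Sh x)"
      using f by (intro continuous_on_tendsto_compose[OF continuous_on_int_iter])
        (auto simp: homeomorphism_def)
    moreover have "(\<lambda>n. ?x n i) \<longlonglongrightarrow> x i"
      by (rule tendsto_truncate_orbit_at)
    ultimately have "(\<lambda>n. dist (int_iter f i (Sh (?x n))) (?x n i)) \<longlonglongrightarrow> dist (int_iter f i (Sh x)) (x i)"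
      by (rule tendsto_dist)
    then show "dist (int_iter f i (Sh x)) (x i) \<le> \<epsilon>"
      by (rule LIMSEQ_le_const2) (use le in auto)
  qed
  with \<gamma> show thesis using that by blast
qed

theorem proposition4p6:
  fixes f :: "'a::metric_space \<Rightarrow> 'a" and \<delta> :: real and Sh :: "(int \<Rightarrow> 'a) \<Rightarrow> 'a"
  assumes "compact (UNIV :: 'a set)"
    and "homeomorphism UNIV UNIV f (inv f)"
    and "L_shadowing_map f \<delta> Sh"
  shows "shadowing_map f \<delta> Sh"
  unfolding shadowing_map_def
proof (intro conjI allI impI)
  show "pseudo_orbit_map f \<delta> Sh"
    using assms(3) by (simp add: L_shadowing_map_def)
next
  fix \<epsilon> :: real
  assume "\<epsilon> > 0"
  then have "\<epsilon> / 2 > 0" by simp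
  then obtain \<gamma> where \<gamma>: "\<gamma> \<in> {0<..\<delta>}"
    and near: "\<And>x. x \<in> pseudo_orbits f \<gamma> \<Longrightarrow> shadows f (\<epsilon> / 2) (Sh x) x"
    using L_shadowing_map_shadows[OF assms(2,3)] by metis
  have "dist (int_iter f i (Sh x)) (Sh (int_iter shift i x)) \<le> \<epsilon>"
    if x: "x \<in> pseudo_orbits f \<gamma>" for x i
  proof -
    have 1: "dist (int_iter f i (Sh x)) (x i) \<le> \<epsilon> / 2"
      using near[OF x] by (simp add: shadows_def)
    have "dist (int_iter f 0 (Sh (int_iter shift i x))) (int_iter shift i x 0) \<le> \<epsilon> / 2"
      using near[OF int_iter_shift_pseudo_orbits[OF x]] unfolding shadows_def by blast
    then have 2: "dist (Sh (int_iter shift i x)) (x i) \<le> \<epsilon> / 2"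
      by (simp add: int_iter_shift)
    show ?thesis
      using dist_triangle2[of "int_iter f i (Sh x)" "Sh (int_iter shift i x)" "x i"] 1 2 by linarith
  qed
  with \<gamma> show "\<exists>\<gamma>\<in>{0<..\<delta>}. \<forall>x\<in>pseudo_orbits f \<gamma>. \<forall>i.
      dist (int_iter f i (Sh x)) (Sh (int_iter shift i x)) \<le> \<epsilon>"
    by blast
qed

end
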